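(* Let $\mathbb{X}$, $a$, $b$, $\mathbb{W}$, $u_{\mathbb{W}}$, $u^{\mathrm{loc}}_{\mathbb{W}}$, $\widetilde u_{\mathbb{W}}$, $\xi_1,\dots,\xi_L$, $\mathbb{Y}$, $u_{\mathbb{Y}}$, $u_{\mathbb{X}}$ be as described in the context, and suppose that $\dim\mathbb{Y}=L+1$ (in particular $\widetilde u_{\mathbb{W}}\neq 0$). Let $\mathsf{A}=(A_{ij})\in\mathbb{R}^{L\times L}$, $\mathsf{b}=(b_i),\mathsf{c}=(c_i)\in\mathbb{R}^L$ be given by $A_{ij}:=a(\xi_j,\xi_i)$, $b_i:=b(\xi_i)$, $c_i:=a(\widetilde u_{\mathbb{W}},\xi_i)$ for $i,j\in\{1,\dots,L\}$, and set $$\delta:=b(u^{\mathrm{loc}}_{\mathbb{W}})-\|u^{\mathrm{loc}}_{\mathbb{W}}\|_{\mathbb{X}}^2,\qquad a_{00}:=\|u_{\mathbb{W}}\|_{\mathbb{X}}^2-\|u^{\mathrm{loc}}_{\mathbb{W}}\|_{\mathbb{X}}^2-2\delta.$$ Consider the symmetric linear system $$\begin{pmatrix}a_{00}&\mathsf{c}^\top\\ \mathsf{c}&\mathsf{A}\end{pmatrix}\begin{pmatrix}\epsilon\\ \mathsf{y}\end{pmatrix}=\begin{pmatrix}\delta\\ \mathsf{b}-\mathsf{c}\end{pmatrix}$$ with solution components $\epsilon\in\mathbb{R}$ and $\mathsf{y}\in\mathbb{R}^L$. Then the predicted error reduction $\Delta e_{\mathbb{W},\mathbb{Y}}^2:=\|u_{\mathbb{X}}-u_{\mathbb{W}}\|_{\mathbb{X}}^2-\|u_{\mathbb{X}}-u_{\mathbb{Y}}\|_{\mathbb{X}}^2$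 is given by $$\Delta e_{\mathbb{W},\mathbb{Y}}^2=\mathsf{y}^\top(\mathsf{b}-\mathsf{c})-\|u^{\mathrm{loc}}_{\mathbb{W}}\|_{\mathbb{X}}^2+\epsilon\,\delta.$$
   Context: $\mathbb{X}$ is a real Hilbert space, $a:\mathbb{X}\times\mathbb{X}\to\mathbb{R}$ is a bounded, symmetric and coercive bilinear form, with induced norm $\|v\|_{\mathbb{X}}:=a(v,v)^{1/2}$, and $b:\mathbb{X}\to\mathbb{R}$ is a bounded linear form. $u_{\mathbb{X}}\in\mathbb{X}$ is the unique solution of $a(u_{\mathbb{X}},v)=b(v)$ for all $v\in\mathbb{X}$. $\mathbb{W}=\operatorname{span}\{\phi_1,\dots,\phi_N\}\subseteq\mathbb{X}$ is a subspace of finite dimension $N\ge 1$ with basis $\phi_1,\dots,\phi_N$, and $u_{\mathbb{W}}\in\mathbb{W}$ is the unique solution of $a(u_{\mathbb{W}},w)=b(w)$ for all $w\in\mathbb{W}$. For an index subset $\mathcal{I}^{\mathrm{loc}}\subset\{1,\dots,N\}$ let $\mathbb{W}^{\mathrm{loc}}:=\operatorname{span}\{\phi_i: i\in\mathcal{I}^{\mathrm{loc}}\}$, and let $\Pi^{\mathrm{loc}}:\mathbb{W}\to\mathbb{W}^{\mathrm{loc}}$ be the linear projection $\sum_{i=1}^N v_i\phi_i\mapsto\sum_{i\in\mathcal{I}^{\mathrm{loc}}}v_i\phi_i$. Set $u^{\mathrm{loc}}_{\mathbb{W}}:=\Pi^{\mathrm{loc}}u_{\mathbb{W}}$ and $\widetilde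 u_{\mathbb{W}}:=u_{\mathbb{W}}-u^{\mathrm{loc}}_{\mathbb{W}}$. $\xi_1,\dots,\xi_L\in\mathbb{X}$ are linearly independent, and $\mathbb{Y}:=\operatorname{span}\{\widetilde u_{\mathbb{W}},\xi_1,\dots,\xi_L\}\subseteq\mathbb{X}$. $u_{\mathbb{Y}}\in\mathbb{Y}$ is the unique solution of $a(u_{\mathbb{Y}},v)=b(v)$ for all $v\in\mathbb{Y}$. *)

theory Defs
  imports "HOL-Analysis.Inner_Product" "Jordan_Normal_Form.Matrix"
begin

definition coercive :: "('x::real_normed_vector \<Rightarrow> 'x \<Rightarrow> real) \<Rightarrow> bool" where
  "coercive a \<longleftrightarrow> (\<exists>\<alpha>>0. \<forall>v. \<alpha> * (norm v)\<^sup>2 \<le> a v v)"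

definition energy_norm :: "('x \<Rightarrow> 'x \<Rightarrow> real) \<Rightarrow> 'x \<Rightarrow> real" where
  "energy_norm a v = sqrt (a v v)"

definition galerkin_solution ::
    "('x \<Rightarrow> 'x \<Rightarrow> real) \<Rightarrow> ('x \<Rightarrow> real) \<Rightarrow> 'x set \<Rightarrow> 'x \<Rightarrow> bool" where
  "galerkin_solution a b V u \<longleftrightarrow> u \<in> V \<and> (\<forall>v\<in>V. a u v = b v)"

text \<open>Independence of the family, not merely of its range: repetitions are excluded.\<close>

definition independent_family :: "(nat \<Rightarrow> 'x::real_vector) \<Rightarrow> nat \<Rightarrow> bool" where
  "independent_family f n \<longleftrightarrow> inj_on f {..<n} \<and> independent (f ` {..<n})"

text \<open>Meaningful for an independent family \<open>\<phi>\<close> and \<open>v\<close> in its span, where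
  \<open>representation (\<phi> ` {..<N}) v (\<phi> i)\<close> is the coefficient of \<open>\<phi> i\<close> in \<open>v\<close>.\<close>

definition local_projection ::
    "(nat \<Rightarrow> 'x::real_vector) \<Rightarrow> nat \<Rightarrow> nat set \<Rightarrow> 'x \<Rightarrow> 'x" where
  "local_projection \<phi> N I v = (\<Sum>i\<in>I. representation (\<phi> ` {..<N}) v (\<phi> i) *\<^sub>R \<phi> i)"

end

theory Submission
  imports Defs
begin

text \<open>
  A Galerkin solution \<open>u\<close> is orthogonal in \<open>a\<close> to its error \<open>u\<^sub>X - u\<close>, so by Pythagoras the
  squared energy norm of the error is \<open>b u\<^sub>X - b u\<close> (lemma \<open>galerkin_error_squared\<close>). The error
  reduction is therefore \<open>b u\<^sub>Y - b u\<^sub>W\<close>, in which \<open>u\<^sub>X\<close> no longer occurs.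

  The bordered system is the Galerkin system of \<open>Y\<close> with the unknown shifted by \<open>u\<^sub>t\<close>: with
  \<open>z = (1 + \<epsilon>) *\<^sub>R u\<^sub>t + (\<Sum>i<L. y\<^sub>i *\<^sub>R \<xi>\<^sub>i)\<close>, its rows say that \<open>a z\<close> and \<open>b\<close> agree on
  \<open>u\<^sub>t\<close> and on every \<open>\<xi>\<^sub>i\<close>. For the first row this uses that \<open>u\<^sub>l\<^sub>o\<^sub>c\<close> is itself in \<open>W\<close>, so
  that \<open>a u\<^sub>W u\<^sub>l\<^sub>o\<^sub>c = b u\<^sub>l\<^sub>o\<^sub>c\<close>; then \<open>a\<^sub>0\<^sub>0\<close> is the squared energy norm of \<open>u\<^sub>t\<close>, and
  \<open>a\<^sub>0\<^sub>0 + \<delta> = b u\<^sub>t\<close>. So \<open>z\<close> solves the problem on \<open>Y\<close>, whence \<open>b u\<^sub>Y = b z\<close>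
  (lemma \<open>galerkin_solution_functional_unique\<close>). Expanding
  \<open>b z - b u\<^sub>W\<close> and eliminating \<open>a\<^sub>0\<^sub>0 * \<epsilon>\<close> with the first row gives the formula.
\<close>

lemma energy_norm_squared:
  assumes "coercive a"
  shows "(energy_norm a v)\<^sup>2 = a v v"
proof -
  obtain \<alpha> where "\<alpha> > 0" "\<alpha> * (norm v)\<^sup>2 \<le> a v v"
    using assms unfolding coercive_def by blast
  moreover from this(1) have "0 \<le> \<alpha> * (norm v)\<^sup>2" by simp
  ultimately have "0 \<le> a v v" by linarith
  then show ?thesis by (simp add: energy_norm_def)
qed

lemma galerkin_error_squared:
  assumes bil: "bounded_bilinear a" and sym: "\<And>v w. a v w = a w v" and coer: "coercive a"
    and ux: "galerkin_solution a b UNIV u\<^sub>X" and u: "galerkin_solution a b V u"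
  shows "(energy_norm a (u\<^sub>X - u))\<^sup>2 = b u\<^sub>X - b u"
proof -
  have "a u\<^sub>X u\<^sub>X = b u\<^sub>X" "a u\<^sub>X u = b u" "a u u = b u"
    using ux u by (auto simp: galerkin_solution_def)
  moreover have "a u u\<^sub>X = a u\<^sub>X u" by (rule sym)
  ultimately show ?thesis
    by (simp add: energy_norm_squared[OF coer] bounded_bilinear.diff_left[OF bil]
        bounded_bilinear.diff_right[OF bil])
qed

text \<open>Testing each of two solutions with the other one gives the same number by symmetry; so
  the value of \<open>b\<close> is determined by the subspace alone.\<close>

lemma galerkin_solution_functional_unique:
  assumes sym: "\<And>v w. a v w = a w v"
    and "galerkin_solution a b V u" and "galerkin_solution a b V u'"
  shows "b u = b u'"
  using assms unfolding galerkin_solution_def by metis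

lemma galerkin_solution_span:
  assumes bil: "bounded_bilinear a" and lin: "bounded_linear b"
    and "u \<in> span S" and test: "\<And>v. v \<in> S \<Longrightarrow> a u v = b v"
  shows "galerkin_solution a b (span S) u"
proof -
  have "linear (a u)"
    using bounded_bilinear.bounded_linear_right[OF bil] by (rule bounded_linear.linear)
  then have "a u v = b v" if "v \<in> span S" for v
    using bounded_linear.linear[OF lin] that test by (rule linear_eq_on)
  then show ?thesis using assms(3) by (simp add: galerkin_solution_def)
qed

lemma local_projection_in_span:
  assumes "I \<subseteq> {..<N}"
  shows "local_projection \<phi> N I v \<in> span (\<phi> ` {..<N})"
  unfolding local_projection_def using assms
  by (intro span_sum span_scale span_base) auto

lemma bordered_system_rows:
  fixes \<alpha> \<beta> \<epsilon> :: "'a::comm_ring_1"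
  assumes A: "A \<in> carrier_mat n n" and c: "c \<in> carrier_vec n" and y: "y \<in> carrier_vec n"
    and sys: "four_block_mat (mat 1 1 (\<lambda>_. \<alpha>)) (mat_of_row c) (transpose_mat (mat_of_row c)) A
           *\<^sub>v vCons \<epsilon> y = vCons \<beta> d"
  shows "\<alpha> * \<epsilon> + scalar_prod c y = \<beta>"
    and "\<And>i. i < n \<Longrightarrow> c $ i * \<epsilon> + scalar_prod (row A i) y = d $ i"
proof -
  let ?M = "four_block_mat (mat 1 1 (\<lambda>_. \<alpha>)) (mat_of_row c) (transpose_mat (mat_of_row c)) A"
  have B: "mat_of_row c \<in> carrier_mat 1 n" "transpose_mat (mat_of_row c) \<in> carrier_mat n 1"
    using c by auto
  have M: "?M \<in> carrier_mat (Suc n) (Suc n)"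
    using four_block_carrier_mat[of "mat 1 1 (\<lambda>_. \<alpha>)" 1 1 A n n] A by simp
  have row0: "row ?M 0 = vCons \<alpha> c"
    by (rule eq_vecI) (use A B c in \<open>auto simp: row_def less_Suc_eq_0_disj\<close>)
  have rowS: "row ?M (Suc i) = vCons (c $ i) (row A i)" if "i < n" for i
    by (rule eq_vecI) (use A B c that in \<open>auto simp: row_def less_Suc_eq_0_disj\<close>)
  have ent: "scalar_prod (row ?M i) (vCons \<epsilon> y) = vCons \<beta> d $ i" if "i < Suc n" for i
    using index_mult_mat_vec[of i ?M "vCons \<epsilon> y"] carrier_matD(1)[OF M] that
    unfolding sys by metis
  show "\<alpha> * \<epsilon> + scalar_prod c y = \<beta>"
    using ent[of 0] row0 by simp
  show "c $ i * \<epsilon> + scalar_prod (row A i) y = d $ i" if "i < n" for i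
    using ent[of "Suc i"] rowS[OF that] that by simp
qed

theorem proposition2:
  fixes a :: "'x::{real_inner, complete_space} \<Rightarrow> 'x \<Rightarrow> real"
    and b :: "'x \<Rightarrow> real"
    and \<phi> \<xi> :: "nat \<Rightarrow> 'x"
    and N L :: nat
    and I\<^sub>l\<^sub>o\<^sub>c :: "nat set"
    and W Y :: "'x set"
    and u\<^sub>X u\<^sub>W u\<^sub>l\<^sub>o\<^sub>c u\<^sub>t u\<^sub>Y :: 'x
    and A :: "real mat"
    and bv c y :: "real vec"
    and \<delta> a\<^sub>0\<^sub>0 \<epsilon> :: real
  assumes "bounded_bilinear a"
    and "\<And>v w. a v w = a w v"
    and "coercive a"
    and "bounded_linear b"
    and "galerkin_solution a b UNIV u\<^sub>X"
    and "N \<ge> 1"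
    and "independent_family \<phi> N"
    and "W = span (\<phi> ` {..<N})"
    and "galerkin_solution a b W u\<^sub>W"
    and "I\<^sub>l\<^sub>o\<^sub>c \<subseteq> {..<N}"
    and "u\<^sub>l\<^sub>o\<^sub>c = local_projection \<phi> N I\<^sub>l\<^sub>o\<^sub>c u\<^sub>W"
    and "u\<^sub>t = u\<^sub>W - u\<^sub>l\<^sub>o\<^sub>c"
    and "independent_family \<xi> L"
    and "Y = span (insert u\<^sub>t (\<xi> ` {..<L}))"
    and "dim Y = L + 1"
    and "galerkin_solution a b Y u\<^sub>Y"
    and "A = mat L L (\<lambda>(i, j). a (\<xi> j) (\<xi> i))"
    and "bv = vec L (\<lambda>i. b (\<xi> i))"
    and "c = vec L (\<lambda>i. a u\<^sub>t (\<xi> i))"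
    and "\<delta> = b u\<^sub>l\<^sub>o\<^sub>c - (energy_norm a u\<^sub>l\<^sub>o\<^sub>c)\<^sup>2"
    and "a\<^sub>0\<^sub>0 = (energy_norm a u\<^sub>W)\<^sup>2 - (energy_norm a u\<^sub>l\<^sub>o\<^sub>c)\<^sup>2 - 2 * \<delta>"
    and "y \<in> carrier_vec L"
    and "four_block_mat (mat 1 1 (\<lambda>_. a\<^sub>0\<^sub>0)) (mat_of_row c) (transpose_mat (mat_of_row c)) A
           *\<^sub>v vCons \<epsilon> y = vCons \<delta> (bv - c)"
  shows "(energy_norm a (u\<^sub>X - u\<^sub>W))\<^sup>2 - (energy_norm a (u\<^sub>X - u\<^sub>Y))\<^sup>2
           = scalar_prod y (bv - c) - (energy_norm a u\<^sub>l\<^sub>o\<^sub>c)\<^sup>2 + \<epsilon> * \<delta>"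
proof -
  note bil = assms(1) and sym = assms(2) and coer = assms(3) and lin = assms(4)
  interpret a: bounded_bilinear a by (rule bil)
  interpret b: bounded_linear b by (rule lin)
  note norm_sq = energy_norm_squared[OF coer]

  have "u\<^sub>l\<^sub>o\<^sub>c \<in> W" "u\<^sub>W \<in> W"
    using assms(8-11) local_projection_in_span by (auto simp: galerkin_solution_def)
  then have "a u\<^sub>W u\<^sub>l\<^sub>o\<^sub>c = b u\<^sub>l\<^sub>o\<^sub>c" and WW: "a u\<^sub>W u\<^sub>W = b u\<^sub>W"
    using assms(9) by (auto simp: galerkin_solution_def)
  then have tt: "a u\<^sub>t u\<^sub>t = a\<^sub>0\<^sub>0" and bt: "b u\<^sub>t = a\<^sub>0\<^sub>0 + \<delta>"
    using sym[of u\<^sub>l\<^sub>o\<^sub>c u\<^sub>W] assms(12,20,21)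
    by (simp_all add: norm_sq a.diff_left a.diff_right b.diff)

  \<comment> \<open>The system determines the correction to \<open>u\<^sub>t\<close>, so its first unknown enters as \<open>1 + \<epsilon>\<close>.\<close>
  define s where "s = (\<Sum>i<L. y $ i *\<^sub>R \<xi> i)"
  define z where "z = (1 + \<epsilon>) *\<^sub>R u\<^sub>t + s"
  have "A \<in> carrier_mat L L" "c \<in> carrier_vec L" using assms(17,19) by auto
  note rows = bordered_system_rows[OF this assms(22,23)]
  have st: "a s u\<^sub>t = scalar_prod c y"
    unfolding sym[of s]
    using assms(19,22)
    by (simp add: s_def a.sum_right a.scaleR_right scalar_prod_def atLeast0LessThan mult.commute)
  have s\<xi>: "a s (\<xi> i) = scalar_prod (row A i) y" if "i < L" for i
    using assms(17,22) that
    by (simp add: s_def a.sum_left a.scaleR_left scalar_prod_def atLeast0LessThan mult.commute)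
  have bs: "b s = scalar_prod y bv"
    using assms(18) by (simp add: s_def b.sum b.scaleR scalar_prod_def atLeast0LessThan)

  have "galerkin_solution a b Y z"
    unfolding assms(14)
  proof (rule galerkin_solution_span[OF bil lin])
    show "z \<in> span (insert u\<^sub>t (\<xi> ` {..<L}))"
      unfolding z_def s_def by (intro span_add span_scale span_sum span_base) auto
    fix v assume "v \<in> insert u\<^sub>t (\<xi> ` {..<L})"
    then consider "v = u\<^sub>t" | i where "i < L" "v = \<xi> i" by auto
    then show "a z v = b v"
    proof cases
      case 1
      then show ?thesis
        using rows(1) by (simp add: z_def a.add_left a.scaleR_left tt st bt algebra_simps)
    next
      case 2
      then show ?thesis
        using rows(2)[of i] assms(18,19)
        by (simp add: z_def a.add_left a.scaleR_left s\<xi> algebra_simps)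
    qed
  qed
  then have bY: "b u\<^sub>Y = b z"
    using galerkin_solution_functional_unique[OF sym assms(16)] by blast

  have "scalar_prod y (bv - c) = scalar_prod y bv - scalar_prod c y"
    using assms(18,19,22)
    by (simp add: scalar_prod_minus_distrib[of _ L] comm_scalar_prod[of _ L])
  moreover have "b u\<^sub>l\<^sub>o\<^sub>c = \<delta> + (energy_norm a u\<^sub>l\<^sub>o\<^sub>c)\<^sup>2" using assms(20) by simp
  moreover have "b u\<^sub>W = b u\<^sub>t + b u\<^sub>l\<^sub>o\<^sub>c" using assms(12) by (simp add: b.diff)
  moreover have "b z = (1 + \<epsilon>) * b u\<^sub>t + scalar_prod y bv"
    by (simp add: z_def b.add b.scaleR bs)
  ultimately show ?thesis
    using rows(1) galerkin_error_squared[OF bil sym coer assms(5) assms(9)]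
      galerkin_error_squared[OF bil sym coer assms(5) assms(16)]
    by (simp add: bY bt algebra_simps)
qed

end
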